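(* Let $k\ge 1$ and $m\ge 2k$ be integers. Then $$\mathrm{forb}(m,\{Q_9,1_{k,1}\})=1+(k-1)m-\binom{k-1}{2}.$$
   Context: A matrix is simple if it is a $(0,1)$-matrix with no repeated columns. $F\prec A$ means that some submatrix of $A$ is a row and column permutation of $F$. For a family $\mathcal F$ of $(0,1)$-matrices, $\mathrm{forb}(m,\mathcal F)$ is the maximum number of columns of an $m$-rowed simple matrix $A$ with $F\nprec A$ for all $F\in\mathcal F$. $1_{k,1}$ is the $k\times 1$ column of $1$'s, and $$Q_9=\begin{bmatrix}1&0\\1&0\\0&1\\0&1\end{bmatrix}.$$ *)

theory Defs
  imports "Jordan_Normal_Form.DL_Submatrix" "HOL-Combinatorics.Permutations"
begin

definition zero_one_mat :: "int mat \<Rightarrow> bool" where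
  "zero_one_mat A \<longleftrightarrow> elements_mat A \<subseteq> {0, 1}"

definition simple_mat :: "int mat \<Rightarrow> bool" where
  "simple_mat A \<longleftrightarrow> zero_one_mat A \<and> distinct (cols A)"

definition row_col_permutation :: "int mat \<Rightarrow> int mat \<Rightarrow> bool" where
  "row_col_permutation F B \<longleftrightarrow>
     (\<exists>p q. p permutes {..<dim_row F} \<and> q permutes {..<dim_col F} \<and>
        B = mat (dim_row F) (dim_col F) (\<lambda>(i, j). F $$ (p i, q j)))"

definition configuration_of :: "int mat \<Rightarrow> int mat \<Rightarrow> bool"  (infix \<open>\<prec>\<close> 50) where
  "F \<prec> A \<longleftrightarrow>
     (\<exists>I J. I \<subseteq> {..<dim_row A} \<and> J \<subseteq> {..<dim_col A} \<and>
        row_col_permutation F (submatrix A I J))"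

definition avoiding_mats :: "nat \<Rightarrow> int mat set \<Rightarrow> int mat set" where
  "avoiding_mats m \<F> =
     {A. dim_row A = m \<and> simple_mat A \<and> (\<forall>F\<in>\<F>. \<not> F \<prec> A)}"

(* Max is meaningful here: the set is finite by finite_dim_col_avoiding_mats, and it is nonempty
   (it contains 0, from the matrix without columns) as long as every F in the family has at
   least one column. *)
definition forb :: "nat \<Rightarrow> int mat set \<Rightarrow> nat" where
  "forb m \<F> = Max (dim_col ` avoiding_mats m \<F>)"

definition Q9 :: "int mat" where
  "Q9 = mat_of_rows_list 2 [[1, 0], [1, 0], [0, 1], [0, 1]]"

definition ones_mat :: "nat \<Rightarrow> nat \<Rightarrow> int mat" where
  "ones_mat k l = mat k l (\<lambda>_. 1)"

lemma finite_dim_col_avoiding_mats: "finite (dim_col ` avoiding_mats m \<F>)"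
proof -
  let ?L = "{xs :: int list. set xs \<subseteq> {0, 1} \<and> length xs = m}"
  have fin: "finite ?L" by (rule finite_lists_length_eq) simp
  have "dim_col A \<le> card (vec_of_list ` ?L)" if "A \<in> avoiding_mats m \<F>" for A
  proof -
    from that have A: "dim_row A = m" "elements_mat A \<subseteq> {0, 1}" "distinct (cols A)"
      by (auto simp: avoiding_mats_def simple_mat_def zero_one_mat_def)
    have "set (cols A) \<subseteq> vec_of_list ` ?L"
    proof
      fix v assume "v \<in> set (cols A)"
      then obtain j where j: "j < dim_col A" "v = col A j"
        by (auto simp: cols_def)
      have v: "v $ i \<in> {0, 1}" if "i < m" for i
      proof -
        have "A $$ (i, j) \<in> elements_mat A"
          using that j(1) A(1) by (intro elements_matI[of A m "dim_col A" i j]) auto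
        with A(2) show ?thesis using j that A(1) by auto
      qed
      have "dim_vec v = m" using j A(1) by simp
      moreover have "set (list_of_vec v) \<subseteq> {0, 1}"
      proof
        fix x assume "x \<in> set (list_of_vec v)"
        then obtain i where "i < m" "x = v $ i"
          using \<open>dim_vec v = m\<close> by (auto simp: in_set_conv_nth list_of_vec_index)
        with v show "x \<in> {0, 1}" by blast
      qed
      ultimately have "list_of_vec v \<in> ?L" by simp
      then show "v \<in> vec_of_list ` ?L"
        by (metis image_eqI vec_list)
    qed
    then have "card (set (cols A)) \<le> card (vec_of_list ` ?L)"
      using fin by (intro card_mono) auto
    then show ?thesis using distinct_card[OF A(3)] by simp
  qed
  then show ?thesis
    by (intro finite_subset[OF _ finite_atMost]) auto
qed

end

theory Submission
  imports Defs
begin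

text \<open>Sets of equal size \<open>s\<close> that pairwise differ in at most one element either all contain
  the intersection of two of them or all lie in their union, so for \<open>1 \<le> s\<close> and \<open>2 * s \<le> m\<close>
  there are at most \<open>m - s + 1\<close> of them. Summing over the sizes \<open>s < k\<close> bounds the family of
  column supports of an avoiding matrix. The sets \<open>insert x {..<t}\<close> with \<open>t < k - 1\<close> and
  \<open>t \<le> x < m\<close> together with the empty set attain every one of these bounds at once.\<close>

section \<open>Families of sets\<close>

text \<open>Write C for \<open>A \<inter> B\<close>; then \<open>A\<close> and \<open>B\<close> are
  C with one extra point each. A member missing a point of C is forced into
  \<open>A \<union> B\<close>, a member leaving \<open>A \<union> B\<close> is forced to contain C,
  and two members of these two kinds would differ in two points.\<close>

lemma star_or_co_star:
  assumes fin: "finite V" and sub: "\<And>A. A \<in> \<A> \<Longrightarrow> A \<subseteq> V" and cd: "\<And>A. A \<in> \<A> \<Longrightarrow> card A = Suc t"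
    and diff: "\<And>A B. A \<in> \<A> \<Longrightarrow> B \<in> \<A> \<Longrightarrow> card (A - B) \<le> 1"
    and A: "A \<in> \<A>" and B: "B \<in> \<A>" and "A \<noteq> B"
  shows "(\<forall>D\<in>\<A>. A \<inter> B \<subseteq> D) \<or> (\<forall>D\<in>\<A>. D \<subseteq> A \<union> B)"
proof -
  have finA: "finite X" if "X \<in> \<A>" for X
    using sub[OF that] fin finite_subset by blast
  have diff': "x = y" if "X \<in> \<A>" "Y \<in> \<A>" "x \<in> X" "x \<notin> Y" "y \<in> X" "y \<notin> Y" for X Y x y
    using card_le_Suc0_iff_eq[of "X - Y"] diff[OF that(1,2)] finA[OF that(1)] that by auto
  have ex: "\<exists>x. x \<in> X \<and> x \<notin> Y" if "X \<in> \<A>" "Y \<in> \<A>" "X \<noteq> Y" for X Y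
    using card_subset_eq[of Y X] finA[OF that(2)] cd[OF that(1)] cd[OF that(2)] that(3) by auto
  obtain a where a: "a \<in> A" "a \<notin> B" using ex[OF A B \<open>A \<noteq> B\<close>] by blast
  obtain b where b: "b \<in> B" "b \<notin> A" using ex[OF B A] \<open>A \<noteq> B\<close> by blast
  \<comment> \<open>The only point that \<open>A - D\<close> may have is \<open>c\<close>, so
    \<open>a\<close> stays in \<open>D\<close>, and likewise \<open>b\<close>. Now \<open>b\<close>
    uses up \<open>D - A\<close>, which leaves no room for a point outside the union.\<close>
  have D_in: "D \<subseteq> A \<union> B \<and> a \<in> D \<and> b \<in> D" if "D \<in> \<A>" "c \<in> A" "c \<in> B" "c \<notin> D" for D c
  proof -
    have "a \<in> D" using diff'[OF A that(1), of a c] a that by auto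
    moreover have "b \<in> D" using diff'[OF B that(1), of b c] b that by auto
    moreover have "D \<subseteq> A \<union> B"
    proof
      fix x assume "x \<in> D"
      then show "x \<in> A \<union> B"
        using diff'[OF that(1) A, of b x] b \<open>b \<in> D\<close> by blast
    qed
    ultimately show ?thesis by blast
  qed
  show ?thesis
  proof (rule ccontr)
    assume "\<not> ?thesis"
    then obtain D c E y where D: "D \<in> \<A>" "c \<in> A" "c \<in> B" "c \<notin> D"
      and E: "E \<in> \<A>" "y \<in> E" "y \<notin> A" "y \<notin> B" by blast
    \<comment> \<open>\<open>E\<close> leaves the union, so by \<open>D_in\<close> it cannot miss
      \<open>c\<close>. Both \<open>c\<close> and \<open>y\<close> then lie in
      \<open>E - D\<close>.\<close>
    have "c \<in> E" using D_in[OF E(1) D(2,3)] E by blast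
    moreover have "y \<notin> D" using D_in[OF D] E by blast
    ultimately show False using diff'[OF E(1) D(1), of c y] D E by auto
  qed
qed

text \<open>If all members contain the \<open>t\<close>-set \<open>A \<inter> B\<close>, each is
  determined by its one further point, which leaves \<open>card V - t\<close> choices. If all lie in
  the \<open>(t + 2)\<close>-set \<open>A \<union> B\<close>, each is that set minus one point, and
  \<open>t + 2 \<le> card V - t\<close> is a rearrangement of hypothesis \<open>V\<close>.\<close>

lemma card_uniform_layer_le:
  assumes fin: "finite V" and sub: "\<And>A. A \<in> \<A> \<Longrightarrow> A \<subseteq> V" and cd: "\<And>A. A \<in> \<A> \<Longrightarrow> card A = Suc t"
    and diff: "\<And>A B. A \<in> \<A> \<Longrightarrow> B \<in> \<A> \<Longrightarrow> card (A - B) \<le> 1"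
    and V: "2 * Suc t \<le> card V"
  shows "card \<A> \<le> card V - t"
proof (cases "\<exists>A\<in>\<A>. \<exists>B\<in>\<A>. A \<noteq> B")
  case False
  have "finite \<A>" using sub fin by (intro finite_subset[of \<A> "Pow V"]) auto
  then have "card \<A> \<le> 1" using False by (auto simp: card_le_Suc0_iff_eq)
  then show ?thesis using V by simp
next
  case True
  then obtain A B where A: "A \<in> \<A>" and B: "B \<in> \<A>" and "A \<noteq> B" by blast
  have finA: "finite X" if "X \<in> \<A>" for X
    using sub[OF that] fin finite_subset by blast
  \<comment> \<open>Distinct sets of equal size do not contain each other, so the bound 1 on the
    difference is attained.\<close>
  have "\<not> A \<subseteq> B" using card_subset_eq[of B A] finA[OF B] cd A B \<open>A \<noteq> B\<close> by auto
  then have "card (A - B) \<noteq> 0" using finA[OF A] by auto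
  then have AB: "card (A - B) = 1" using diff[OF A B] by linarith
  have int: "card (A \<inter> B) = t"
    using card_Diff_subset_Int[of A B] AB finA A cd[OF A] card_mono[of A "A \<inter> B"] by auto
  have un: "card (A \<union> B) = Suc (Suc t)"
    using card_Un_Int[OF finA[OF A] finA[OF B]] int cd A B by simp
  from star_or_co_star[OF fin sub cd diff A B \<open>A \<noteq> B\<close>] show ?thesis
  proof
    assume star: "\<forall>D\<in>\<A>. A \<inter> B \<subseteq> D"
    have "\<A> \<subseteq> (\<lambda>x. insert x (A \<inter> B)) ` (V - A \<inter> B)"
    proof
      fix D assume D: "D \<in> \<A>"
      have "card (D - A \<inter> B) = 1"
        using star D int cd[OF D] finA[OF A] by (subst card_Diff_subset) auto
      then obtain x where "D - A \<inter> B = {x}" by (auto simp: card_1_singleton_iff)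
      then have "D = insert x (A \<inter> B)" "x \<in> V - A \<inter> B" using star sub[OF D] D by auto
      then show "D \<in> (\<lambda>x. insert x (A \<inter> B)) ` (V - A \<inter> B)" by blast
    qed
    then have "card \<A> \<le> card (V - A \<inter> B)" using fin by (meson finite_Diff surj_card_le)
    also have "\<dots> = card V - t"
      using int sub[OF A] finA[OF A] by (subst card_Diff_subset) auto
    finally show ?thesis .
  next
    assume costar: "\<forall>D\<in>\<A>. D \<subseteq> A \<union> B"
    have "\<A> \<subseteq> (\<lambda>x. A \<union> B - {x}) ` (A \<union> B)"
    proof
      fix D assume D: "D \<in> \<A>"
      have "card (A \<union> B - D) = 1"
        using costar D un cd[OF D] finA[OF D] by (subst card_Diff_subset) auto
      then obtain x where "A \<union> B - D = {x}" by (auto simp: card_1_singleton_iff)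
      then have "D = A \<union> B - {x}" "x \<in> A \<union> B" using costar D by auto
      then show "D \<in> (\<lambda>x. A \<union> B - {x}) ` (A \<union> B)" by blast
    qed
    then have "card \<A> \<le> card (A \<union> B)" using finA A B by (meson finite_Un surj_card_le)
    then show ?thesis using un V by simp
  qed
qed

text \<open>The family is split by size. The empty set accounts for the summand 1, and size
  \<open>Suc t\<close> with \<open>t < n\<close> satisfies \<open>2 * Suc t \<le> card V\<close>, so
  the bound for a single size applies.\<close>

lemma card_family_le:
  assumes fin: "finite V" and sub: "\<And>A. A \<in> \<A> \<Longrightarrow> A \<subseteq> V" and cd: "\<And>A. A \<in> \<A> \<Longrightarrow> card A \<le> n"
    and diff: "\<And>A B. A \<in> \<A> \<Longrightarrow> B \<in> \<A> \<Longrightarrow> card (A - B) \<le> 1 \<or> card (B - A) \<le> 1"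
    and V: "2 * n \<le> card V"
  shows "card \<A> \<le> 1 + (\<Sum>t<n. card V - t)"
proof -
  have finA: "finite X" if "X \<in> \<A>" for X
    using sub[OF that] fin finite_subset by blast
  have "\<A> \<subseteq> {{}} \<union> (\<Union>t<n. {A \<in> \<A>. card A = Suc t})"
  proof
    fix A assume A: "A \<in> \<A>"
    show "A \<in> {{}} \<union> (\<Union>t<n. {A \<in> \<A>. card A = Suc t})"
      using A cd[OF A] finA[OF A] by (cases "card A") auto
  qed
  moreover have fin\<A>: "finite \<A>" using sub fin by (intro finite_subset[of \<A> "Pow V"]) auto
  ultimately have "card \<A> \<le> card ({{}} \<union> (\<Union>t<n. {A \<in> \<A>. card A = Suc t}))"
    by (intro card_mono) auto
  also have "\<dots> \<le> card {{} :: 'a set} + card (\<Union>t<n. {A \<in> \<A>. card A = Suc t})"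
    by (rule card_Un_le)
  also have "\<dots> \<le> 1 + (\<Sum>t<n. card {A \<in> \<A>. card A = Suc t})"
    using card_UN_le[of "{..<n}" "\<lambda>t. {A \<in> \<A>. card A = Suc t}"] by simp
  also have "\<dots> \<le> 1 + (\<Sum>t<n. card V - t)"
  proof (intro add_left_mono sum_mono)
    fix t assume "t \<in> {..<n}"
    then have t: "2 * Suc t \<le> card V" using V by simp
    have "card (A - B) \<le> 1"
      if "A \<in> {A \<in> \<A>. card A = Suc t}" "B \<in> {A \<in> \<A>. card A = Suc t}" for A B
    proof -
      \<comment> \<open>Equal sizes make both differences equally large, so the disjunction in
        \<open>diff\<close> bounds each of them.\<close>
      have "card (A - B) = card (B - A)"
        using that finA card_Diff_subset_Int[of A B] card_Diff_subset_Int[of B A]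
        by (simp add: Int_commute)
      then show ?thesis using diff[of A B] that by auto
    qed
    then show "card {A \<in> \<A>. card A = Suc t} \<le> card V - t"
      using sub by (intro card_uniform_layer_le[OF fin _ _ _ t]) auto
  qed
  finally show ?thesis .
qed

section \<open>The extremal family and its size\<close>

definition nested_stars :: "nat \<Rightarrow> nat \<Rightarrow> nat set set" where
  "nested_stars n m = insert {} (\<Union>t<n. (\<lambda>x. insert x {..<t}) ` {t..<m})"

lemma finite_nested_stars: "finite (nested_stars n m)"
  by (simp add: nested_stars_def)

text \<open>The layers are disjoint because layer \<open>t\<close> consists of sets of size
  \<open>Suc t\<close>. For \<open>t \<ge> m\<close> the layer is empty, in agreement with the
  truncated \<open>m - t\<close>.\<close>

lemma card_nested_stars: "card (nested_stars n m) = 1 + (\<Sum>t<n. m - t)"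
proof -
  let ?L = "\<lambda>t. (\<lambda>x. insert x {..<t}) ` {t..<m}"
  have size: "card A = Suc t" if "A \<in> ?L t" for A t
    using that by auto
  have "card (\<Union>t<n. ?L t) = (\<Sum>t<n. card (?L t))"
  proof (intro card_UN_disjoint ballI impI)
    fix s t :: nat assume "s \<noteq> t"
    then show "?L s \<inter> ?L t = {}" using size by (metis disjoint_iff nat.inject)
  qed auto
  also have "\<dots> = (\<Sum>t<n. m - t)"
  proof (intro sum.cong refl)
    fix t
    \<comment> \<open>As \<open>x \<ge> t\<close>, the point \<open>x\<close> is the only element of
      its set outside \<open>{..<t}\<close> and can be recovered from it.\<close>
    have "inj_on (\<lambda>x. insert x {..<t}) {t..<m}"
    proof (rule inj_onI)
      fix x y assume "x \<in> {t..<m}" "y \<in> {t..<m}" and eq: "insert x {..<t} = insert y {..<t}"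
      moreover have "x \<in> insert y {..<t}" using eq by blast
      ultimately show "x = y" by auto
    qed
    then show "card (?L t) = m - t" by (simp add: card_image)
  qed
  finally have "card (\<Union>t<n. ?L t) = (\<Sum>t<n. m - t)" .
  moreover have "{} \<notin> (\<Union>t<n. ?L t)" by auto
  ultimately show ?thesis unfolding nested_stars_def by (subst card_insert_disjoint) auto
qed

lemma nested_stars_subset: "A \<in> nested_stars n m \<Longrightarrow> A \<subseteq> {..<m}"
  by (auto simp: nested_stars_def)

lemma card_le_of_nested_stars: "A \<in> nested_stars n m \<Longrightarrow> card A \<le> n"
  by (auto simp: nested_stars_def)

text \<open>The kernels \<open>{..<s}\<close> and \<open>{..<t}\<close> are comparable, so the set
  with the smaller kernel exceeds the other by at most its own extra point.\<close>

lemma nested_stars_diff: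
  assumes "A \<in> nested_stars n m" and "B \<in> nested_stars n m"
  shows "card (A - B) \<le> 1 \<or> card (B - A) \<le> 1"
proof -
  have small: "card (X - Y) \<le> 1" if "X \<subseteq> insert x Y" for X Y and x :: nat
    using that card_mono[of "{x}" "X - Y"] by auto
  consider "A = {}" | "B = {}"
    | s x t y where "A = insert x {..<s}" "B = insert y {..<t}"
    using assms by (auto simp: nested_stars_def)
  then show ?thesis
  proof cases
    case 3
    have "A \<subseteq> insert x B \<or> B \<subseteq> insert y A" unfolding 3 by auto
    then show ?thesis using small by blast
  qed auto
qed

text \<open>The subtracted terms 0, ..., n - 1 add up to \<open>n choose 2\<close>. The hypothesis
  ensures that no difference is truncated.\<close>

lemma int_sum_descending:
  assumes "n \<le> Suc m"
  shows "int (\<Sum>t<n. m - t) = int n * int m - int (n choose 2)"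
  using assms
proof (induction n)
  case (Suc n)
  have "Suc n choose 2 = n + (n choose 2)"
    by (simp add: numeral_2_eq_2)
  with Suc show ?case by (simp add: of_nat_diff algebra_simps)
qed simp

section \<open>Configurations as injections\<close>

text \<open>\<open>pick I\<close> lists \<open>I\<close> in increasing order: strict monotonicity
  gives injectivity, and \<open>card I\<close> distinct values inside \<open>I\<close> exhaust
  it.\<close>

lemma bij_betw_pick:
  assumes "finite I"
  shows "bij_betw (pick I) {..<card I} I"
proof -
  have "inj_on (pick I) {..<card I}"
  proof (rule inj_onI)
    fix x y assume "x \<in> {..<card I}" "y \<in> {..<card I}" "pick I x = pick I y"
    then show "x = y"
      using pick_mono_le[of x I y] pick_mono_le[of y I x] by (metis lessThan_iff less_irrefl nat_neq_iff)
  qed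
  moreover have "pick I ` {..<card I} \<subseteq> I" using pick_in_set_le by auto
  ultimately show ?thesis
    using assms card_subset_eq[of I "pick I ` {..<card I}"] by (simp add: bij_betw_def card_image)
qed

text \<open>\<open>submatrix\<close> keeps the selected indices in increasing order, while an
  injection may list them in any order. Both enumerate the same set, so they differ by the
  permutation \<open>?g\<close>.\<close>

lemma permutes_pick:
  assumes "inj_on f {..<r}"
  obtains p where "p permutes {..<r}" and "\<forall>i<r. f (p i) = pick (f ` {..<r}) i"
proof -
  let ?I = "f ` {..<r}"
  have I: "bij_betw (pick ?I) {..<r} ?I"
    using bij_betw_pick[of ?I] assms by (simp add: card_image)
  let ?g = "inv_into {..<r} f \<circ> pick ?I"
  have g: "bij_betw ?g {..<r} {..<r}"
    using I assms by (meson bij_betw_imageI bij_betw_inv_into bij_betw_trans)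
  \<comment> \<open>\<open>permutes\<close> demands the identity outside the set.\<close>
  define p where "p i = (if i < r then ?g i else i)" for i
  have "bij_betw p {..<r} {..<r}"
    using g by (subst bij_betw_cong[of _ _ ?g]) (auto simp: p_def)
  then have "p permutes {..<r}" by (intro bij_imp_permutes) (auto simp: p_def)
  moreover have "f (p i) = pick ?I i" if "i < r" for i
    using bij_betwE[OF I] that by (auto simp: p_def intro!: f_inv_into_f)
  ultimately show thesis using that by blast
qed

text \<open>This trades index sets and permutations for plain injections, so that a copy of
  \<open>F\<close> can be read off or built by naming its rows and columns.\<close>

lemma configuration_of_iff:
  "F \<prec> A \<longleftrightarrow>
     (\<exists>f g. inj_on f {..<dim_row F} \<and> f ` {..<dim_row F} \<subseteq> {..<dim_row A} \<and>
            inj_on g {..<dim_col F} \<and> g ` {..<dim_col F} \<subseteq> {..<dim_col A} \<and>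
            (\<forall>i<dim_row F. \<forall>j<dim_col F. A $$ (f i, g j) = F $$ (i, j)))"
    (is "_ \<longleftrightarrow> ?R")
proof -
  \<comment> \<open>The dimensions of a submatrix are cardinalities of sets of this shape.\<close>
  have sel: "{i. i < n \<and> i \<in> K} = K" if "K \<subseteq> {..<n}" for K :: "nat set" and n
    using that by auto
  show ?thesis
  proof
    assume "F \<prec> A"
    then obtain I J p q where I: "I \<subseteq> {..<dim_row A}" and J: "J \<subseteq> {..<dim_col A}"
      and p: "p permutes {..<dim_row F}" and q: "q permutes {..<dim_col F}"
      and eq: "submatrix A I J = mat (dim_row F) (dim_col F) (\<lambda>(i, j). F $$ (p i, q j))"
      by (auto simp: configuration_of_def row_col_permutation_def)
    have cI: "card I = dim_row F" and cJ: "card J = dim_col F"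
      using arg_cong[OF eq, of dim_row] arg_cong[OF eq, of dim_col] sel[OF I] sel[OF J]
      by (simp_all add: dim_submatrix)
    \<comment> \<open>Row \<open>i'\<close> of the submatrix is row \<open>p i'\<close> of
      \<open>F\<close>, so row \<open>i\<close> of \<open>F\<close> is found at position
      \<open>inv_into UNIV p i\<close>, which \<open>pick I\<close> sends to a row of
      \<open>A\<close>.\<close>
    have bI: "bij_betw (pick I \<circ> inv_into UNIV p) {..<dim_row F} I"
      using bij_betw_pick[of I] I finite_subset cI permutes_imp_bij[OF permutes_inv[OF p]]
      by (metis bij_betw_trans finite_lessThan)
    have bJ: "bij_betw (pick J \<circ> inv_into UNIV q) {..<dim_col F} J"
      using bij_betw_pick[of J] J finite_subset cJ permutes_imp_bij[OF permutes_inv[OF q]]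
      by (metis bij_betw_trans finite_lessThan)
    have "A $$ ((pick I \<circ> inv_into UNIV p) i, (pick J \<circ> inv_into UNIV q) j) = F $$ (i, j)"
      if "i < dim_row F" "j < dim_col F" for i j
    proof -
      have i': "inv_into UNIV p i < dim_row F" and j': "inv_into UNIV q j < dim_col F"
        using that permutes_in_image[OF permutes_inv[OF p]] permutes_in_image[OF permutes_inv[OF q]]
        by auto
      have "A $$ (pick I (inv_into UNIV p i), pick J (inv_into UNIV q j)) = submatrix A I J $$ (inv_into UNIV p i, inv_into UNIV q j)"
        using i' j' cI cJ sel[OF I] sel[OF J] by (simp add: submatrix_index)
      also have "\<dots> = F $$ (i, j)"
        unfolding eq using i' j' permutes_inverses(1)[OF p] permutes_inverses(1)[OF q] by simp
      finally show ?thesis by simp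
    qed
    moreover have "inj_on (pick I \<circ> inv_into UNIV p) {..<dim_row F}"
      "(pick I \<circ> inv_into UNIV p) ` {..<dim_row F} \<subseteq> {..<dim_row A}"
      "inj_on (pick J \<circ> inv_into UNIV q) {..<dim_col F}"
      "(pick J \<circ> inv_into UNIV q) ` {..<dim_col F} \<subseteq> {..<dim_col A}"
      using bI bJ I J by (simp_all add: bij_betw_def)
    ultimately show ?R by (intro exI conjI allI impI)
  next
    assume ?R
    then obtain f g where f: "inj_on f {..<dim_row F}" "f ` {..<dim_row F} \<subseteq> {..<dim_row A}"
      and g: "inj_on g {..<dim_col F}" "g ` {..<dim_col F} \<subseteq> {..<dim_col A}"
      and eq: "\<forall>i<dim_row F. \<forall>j<dim_col F. A $$ (f i, g j) = F $$ (i, j)"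
      by (elim exE conjE) (rule that)
    obtain p where p: "p permutes {..<dim_row F}"
      "\<forall>i<dim_row F. f (p i) = pick (f ` {..<dim_row F}) i"
      by (rule permutes_pick[OF f(1)])
    obtain q where q: "q permutes {..<dim_col F}"
      "\<forall>j<dim_col F. g (q j) = pick (g ` {..<dim_col F}) j"
      by (rule permutes_pick[OF g(1)])
    let ?I = "f ` {..<dim_row F}" and ?J = "g ` {..<dim_col F}"
    have "submatrix A ?I ?J = mat (dim_row F) (dim_col F) (\<lambda>(i, j). F $$ (p i, q j))"
    proof (rule eq_matI, goal_cases)
      case (1 i j)
      then have ij: "i < dim_row F" "j < dim_col F" by auto
      then have "p i < dim_row F" "q j < dim_col F"
        using permutes_in_image[OF p(1)] permutes_in_image[OF q(1)] by auto
      then have "A $$ (f (p i), g (q j)) = F $$ (p i, q j)"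
        using eq by blast
      then have "F $$ (p i, q j) = A $$ (pick ?I i, pick ?J j)"
        using p(2) q(2) ij by simp
      then show ?case
        using ij sel[OF f(2)] sel[OF g(2)] f(1) g(1) by (simp add: submatrix_index card_image)
    qed (use sel[OF f(2)] sel[OF g(2)] f(1) g(1) in \<open>simp_all add: dim_submatrix card_image\<close>)
    then show "F \<prec> A"
      unfolding configuration_of_def row_col_permutation_def
      using f(2) g(2) p(1) q(1) by (intro exI conjI)
  qed
qed

section \<open>Column supports\<close>

definition col_support :: "int mat \<Rightarrow> nat \<Rightarrow> nat set" where
  "col_support A j = {i. i < dim_row A \<and> A $$ (i, j) = 1}"

lemma finite_col_support [simp]: "finite (col_support A j)"
  by (simp add: col_support_def)

text \<open>A copy of the column of ones amounts to \<open>k\<close> distinct rows inside the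
  support of one column.\<close>

lemma ones_mat_configuration_of_iff:
  "ones_mat k 1 \<prec> A \<longleftrightarrow> (\<exists>j<dim_col A. k \<le> card (col_support A j))"
proof
  assume "ones_mat k 1 \<prec> A"
  then obtain f and g :: "nat \<Rightarrow> nat"
    where f: "inj_on f {..<k}" "f ` {..<k} \<subseteq> {..<dim_row A}"
    and g: "g 0 < dim_col A" and eq: "\<forall>i<k. A $$ (f i, g 0) = 1"
    unfolding configuration_of_iff by (auto simp: ones_mat_def)
  have "f ` {..<k} \<subseteq> col_support A (g 0)" using f(2) eq by (auto simp: col_support_def)
  then have "k \<le> card (col_support A (g 0))"
    using card_mono[OF finite_col_support] card_image[OF f(1)] by (metis card_lessThan)
  then show "\<exists>j<dim_col A. k \<le> card (col_support A j)" using g by auto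
next
  assume "\<exists>j<dim_col A. k \<le> card (col_support A j)"
  then obtain j where j: "j < dim_col A" "k \<le> card (col_support A j)" by blast
  then obtain f where f: "f ` {..<k} \<subseteq> col_support A j" "inj_on f {..<k}"
    using card_le_inj[of "{..<k}" "col_support A j"] by auto
  show "ones_mat k 1 \<prec> A"
    unfolding configuration_of_iff
    by (rule exI[of _ f], rule exI[of _ "\<lambda>_. j"])
      (use f j(1) in \<open>auto simp: ones_mat_def col_support_def inj_on_def\<close>)
qed

lemma two_le_card_iff:
  assumes "finite S"
  shows "2 \<le> card S \<longleftrightarrow> (\<exists>x\<in>S. \<exists>y\<in>S. x \<noteq> y)"
  using card_le_Suc0_iff_eq[OF assms] by (auto simp: not_less_eq_eq numeral_2_eq_2)

text \<open>The index 1 appears as \<open>Suc 0\<close>, the form that the simplifier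
  produces.\<close>

lemma Q9_index:
  "Q9 $$ (0, 0) = 1" "Q9 $$ (Suc 0, 0) = 1" "Q9 $$ (2, 0) = 0" "Q9 $$ (3, 0) = 0"
  "Q9 $$ (0, Suc 0) = 0" "Q9 $$ (Suc 0, Suc 0) = 0" "Q9 $$ (2, Suc 0) = 1" "Q9 $$ (3, Suc 0) = 1"
  by (simp_all add: Q9_def mat_of_rows_list_def)

lemma dim_Q9: "dim_row Q9 = 4" "dim_col Q9 = 2"
  by (simp_all add: Q9_def mat_of_rows_list_def)

lemma lessThan_2_4: "{..<2::nat} = {0, Suc 0}" "{..<4::nat} = {0, Suc 0, 2, 3}"
  by auto

lemma all_less_2_4:
  "(\<forall>j<2::nat. P j) \<longleftrightarrow> P 0 \<and> P (Suc 0)"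
  "(\<forall>i<4::nat. P i) \<longleftrightarrow> P 0 \<and> P (Suc 0) \<and> P 2 \<and> P 3"
  by (auto simp: numeral_2_eq_2 numeral_3_eq_3 numeral_Bit0 less_Suc_eq)

text \<open>The first two rows of \<open>Q9\<close> supply two points of one support outside the
  other, and the last two rows do the same with the columns exchanged.\<close>

lemma Q9_configuration_of_iff:
  assumes "zero_one_mat A"
  shows "Q9 \<prec> A \<longleftrightarrow>
    (\<exists>j<dim_col A. \<exists>l<dim_col A. 2 \<le> card (col_support A j - col_support A l) \<and>
                                 2 \<le> card (col_support A l - col_support A j))"
    (is "_ \<longleftrightarrow> ?R")
proof
  assume "Q9 \<prec> A"
  then obtain f g where f: "inj_on f {..<4}" "f ` {..<4} \<subseteq> {..<dim_row A}"
    and g: "g ` {..<2} \<subseteq> {..<dim_col A}"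
    and eq: "\<forall>i<4. \<forall>j<2. A $$ (f i, g j) = Q9 $$ (i, j)"
    unfolding configuration_of_iff by (auto simp: dim_Q9)
  have "f 0 \<in> col_support A (g 0) - col_support A (g 1)"
    "f 1 \<in> col_support A (g 0) - col_support A (g 1)"
    "f 2 \<in> col_support A (g 1) - col_support A (g 0)"
    "f 3 \<in> col_support A (g 1) - col_support A (g 0)"
    using f(2) eq by (auto simp: col_support_def all_less_2_4 Q9_index lessThan_2_4)
  moreover have "f 0 \<noteq> f 1" "f 2 \<noteq> f 3" using f(1) by (auto simp: inj_on_def lessThan_2_4)
  ultimately have "2 \<le> card (col_support A (g 0) - col_support A (g 1))"
    "2 \<le> card (col_support A (g 1) - col_support A (g 0))"
    by (metis finite_Diff finite_col_support two_le_card_iff)+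
  then show ?R using g by (auto simp: lessThan_2_4)
next
  assume ?R
  then obtain j l where jl: "j < dim_col A" "l < dim_col A"
    and card: "2 \<le> card (col_support A j - col_support A l)"
      "2 \<le> card (col_support A l - col_support A j)"
    by blast
  obtain a b where ab: "a \<in> col_support A j - col_support A l"
      "b \<in> col_support A j - col_support A l" "a \<noteq> b"
    using card(1) by (auto simp: two_le_card_iff)
  obtain c d where cd: "c \<in> col_support A l - col_support A j"
      "d \<in> col_support A l - col_support A j" "c \<noteq> d"
    using card(2) by (auto simp: two_le_card_iff)
  \<comment> \<open>Lying outside a support only says that the entry is not 1;
    \<open>zero_one_mat\<close> makes it 0.\<close>
  have zero: "A $$ (i, h) = 0" if "i < dim_row A" "h < dim_col A" "A $$ (i, h) \<noteq> 1" for i h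
    using assms that elements_matI[of A "dim_row A" "dim_col A" i h]
    by (auto simp: zero_one_mat_def)
  have a: "a < dim_row A" "A $$ (a, j) = 1" "A $$ (a, l) = 0"
    and b: "b < dim_row A" "A $$ (b, j) = 1" "A $$ (b, l) = 0"
    and c: "c < dim_row A" "A $$ (c, j) = 0" "A $$ (c, l) = 1"
    and d: "d < dim_row A" "A $$ (d, j) = 0" "A $$ (d, l) = 1"
    using ab(1,2) cd(1,2) jl zero by (simp_all add: col_support_def)
  \<comment> \<open>Differing entries separate the indices: column \<open>j\<close> holds 1 in rows
    \<open>a\<close>, \<open>b\<close> and 0 in rows \<open>c\<close>, \<open>d\<close>, while row
    \<open>a\<close> separates \<open>j\<close> from \<open>l\<close>.\<close>
  then have ne: "j \<noteq> l" "a \<noteq> c" "a \<noteq> d" "b \<noteq> c" "b \<noteq> d" by auto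
  define f where "f = (\<lambda>i::nat. if i = 0 then a else if i = 1 then b else if i = 2 then c else d)"
  define g where "g = (\<lambda>i::nat. if i = 0 then j else l)"
  have f: "f 0 = a" "f (Suc 0) = b" "f 2 = c" "f 3 = d" and g: "g 0 = j" "g (Suc 0) = l"
    by (simp_all add: f_def g_def)
  have "inj_on f {..<4}" "f ` {..<4} \<subseteq> {..<dim_row A}"
    "inj_on g {..<2}" "g ` {..<2} \<subseteq> {..<dim_col A}"
    unfolding lessThan_2_4 using a(1) b(1) c(1) d(1) ne ab(3) cd(3) jl by (auto simp: f g)
  moreover have "\<forall>i<4. \<forall>j<2. A $$ (f i, g j) = Q9 $$ (i, j)"
    unfolding all_less_2_4 f g Q9_index using a b c d by blast
  ultimately show "Q9 \<prec> A"
    unfolding configuration_of_iff dim_Q9 by (intro exI conjI)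
qed

text \<open>A (0,1)-column is determined by where its ones are. Counting the columns of a simple
  matrix is therefore counting a family of sets.\<close>

lemma inj_on_col_support:
  assumes "simple_mat A"
  shows "inj_on (col_support A) {..<dim_col A}"
proof (rule inj_onI)
  fix j l assume j: "j \<in> {..<dim_col A}" and l: "l \<in> {..<dim_col A}"
    and eq: "col_support A j = col_support A l"
  have "A $$ (i, j) = A $$ (i, l)" if "i < dim_row A" for i
  proof -
    have "A $$ (i, j) \<in> {0, 1}" "A $$ (i, l) \<in> {0, 1}"
      using assms that j l elements_matI[of A "dim_row A" "dim_col A" i]
      by (auto simp: simple_mat_def zero_one_mat_def)
    moreover have "A $$ (i, j) = 1 \<longleftrightarrow> A $$ (i, l) = 1"
      using eq that by (auto simp: col_support_def)
    ultimately show ?thesis by auto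
  qed
  then have "col A j = col A l" using j l by (intro eq_vecI) auto
  then have "cols A ! j = cols A ! l" using j l by simp
  then show "j = l"
    using assms j l nth_eq_iff_index_eq[of "cols A" j l] by (auto simp: simple_mat_def)
qed

text \<open>The witness is the incidence matrix of a repetition-free list of the family. Its
  supports return the listed sets, so equal columns would mean a repeated set.\<close>

lemma obtain_mat_of_family:
  fixes \<A> :: "nat set set"
  assumes "finite \<A>" and sub: "\<And>S. S \<in> \<A> \<Longrightarrow> S \<subseteq> {..<m}"
  obtains A where "dim_row A = m" "dim_col A = card \<A>" "simple_mat A"
    "\<forall>j<dim_col A. col_support A j \<in> \<A>"
proof -
  obtain xs where xs: "set xs = \<A>" "distinct xs"
    using finite_distinct_list[OF assms(1)] by blast
  define A :: "int mat" where
    "A = mat m (length xs) (\<lambda>(i, j). if i \<in> xs ! j then 1 else 0)"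
  have supp: "col_support A j = xs ! j" if "j < length xs" for j
  proof -
    have "xs ! j \<subseteq> {..<m}" using sub nth_mem[OF that] xs(1) by simp
    then have "i < m" if "i \<in> xs ! j" for i using that by auto
    then show ?thesis using that by (auto simp: col_support_def A_def split: if_splits)
  qed
  have "zero_one_mat A"
    by (auto simp: zero_one_mat_def elements_mat_def A_def)
  moreover have "distinct (cols A)"
    unfolding distinct_conv_nth
  proof (intro allI impI notI)
    fix i j assume "i < length (cols A)" "j < length (cols A)" "i \<noteq> j"
      and eq: "cols A ! i = cols A ! j"
    then have ij: "i < length xs" "j < length xs" by (auto simp: A_def)
    then have c: "col A i = col A j" using eq by (simp add: A_def)
    have "A $$ (r, i) = A $$ (r, j)" if "r < m" for r
      using arg_cong[OF c, of "\<lambda>v. v $ r"] that ij by (simp add: A_def)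
    then have "col_support A i = col_support A j" by (auto simp: col_support_def A_def)
    then show False using supp ij xs(2) \<open>i \<noteq> j\<close> by (simp add: nth_eq_iff_index_eq)
  qed
  ultimately have "simple_mat A" by (simp add: simple_mat_def)
  moreover have "col_support A j \<in> \<A>" if "j < dim_col A" for j
  proof -
    have "j < length xs" using that by (simp add: A_def)
    then show ?thesis using supp xs(1) by force
  qed
  moreover have "dim_row A = m" "dim_col A = card \<A>"
    using xs(1) distinct_card[OF xs(2)] by (simp_all add: A_def)
  ultimately show thesis by (intro that allI impI)
qed

theorem proposition7p2:
  fixes k m :: nat
  assumes "k \<ge> 1" and "m \<ge> 2 * k"
  shows "int (forb m {Q9, ones_mat k 1}) =
           1 + (int k - 1) * int m - int ((k - 1) choose 2)"
proof -
  let ?b = "1 + (\<Sum>t<k - 1. m - t)"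
  have "Max (dim_col ` avoiding_mats m {Q9, ones_mat k 1}) = ?b"
  proof (rule Max_eqI[OF finite_dim_col_avoiding_mats])
    fix n assume "n \<in> dim_col ` avoiding_mats m {Q9, ones_mat k 1}"
    then obtain A where A: "dim_row A = m" "simple_mat A" "\<not> Q9 \<prec> A" "\<not> ones_mat k 1 \<prec> A"
      and n: "n = dim_col A" by (auto simp: avoiding_mats_def)
    let ?\<A> = "col_support A ` {..<dim_col A}"
    \<comment> \<open>Avoiding the column of ones bounds the supports by \<open>k - 1\<close>, and
      avoiding \<open>Q9\<close> keeps one of the two differences of any two supports at most
      1.\<close>
    have "card ?\<A> \<le> 1 + (\<Sum>t<k - 1. card {..<m} - t)"
    proof (rule card_family_le)
      fix S assume "S \<in> ?\<A>"
      then show "S \<subseteq> {..<m}" using A(1) by (auto simp: col_support_def)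
      show "card S \<le> k - 1"
        using \<open>S \<in> ?\<A>\<close> A(4) assms(1) unfolding ones_mat_configuration_of_iff
        by (fastforce simp: not_le)
    next
      fix S T assume "S \<in> ?\<A>" "T \<in> ?\<A>"
      then show "card (S - T) \<le> 1 \<or> card (T - S) \<le> 1"
        using A(2,3) Q9_configuration_of_iff[of A] by (fastforce simp: simple_mat_def not_le)
    qed (use assms in auto)
    then show "n \<le> ?b"
      using card_image[OF inj_on_col_support[OF A(2)]] n by simp
  next
    \<comment> \<open>For the lower bound, the matrix whose supports are the nested stars with
      \<open>n = k - 1\<close> has exactly \<open>?b\<close> columns.\<close>
    obtain A where A: "dim_row A = m" "dim_col A = card (nested_stars (k - 1) m)" "simple_mat A"
      and supp: "\<forall>j<dim_col A. col_support A j \<in> nested_stars (k - 1) m"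
      by (rule obtain_mat_of_family[OF finite_nested_stars nested_stars_subset])
    have "\<not> Q9 \<prec> A"
    proof
      assume "Q9 \<prec> A"
      then obtain j l where "j < dim_col A" "l < dim_col A"
        "2 \<le> card (col_support A j - col_support A l)"
        "2 \<le> card (col_support A l - col_support A j)"
        using Q9_configuration_of_iff A(3) unfolding simple_mat_def by blast
      then show False
        using nested_stars_diff[of "col_support A j" "k - 1" m "col_support A l"] supp by auto
    qed
    moreover have "\<not> ones_mat k 1 \<prec> A"
    proof
      assume "ones_mat k 1 \<prec> A"
      then obtain j where "j < dim_col A" "k \<le> card (col_support A j)"
        unfolding ones_mat_configuration_of_iff by blast
      then show False
        using card_le_of_nested_stars[of "col_support A j" "k - 1" m] supp assms(1) by auto
    qed
    ultimately have "A \<in> avoiding_mats m {Q9, ones_mat k 1}"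
      using A(1,3) by (simp add: avoiding_mats_def)
    then show "?b \<in> dim_col ` avoiding_mats m {Q9, ones_mat k 1}"
      using A(2) card_nested_stars by (metis image_eqI)
  qed
  \<comment> \<open>Since \<open>k \<ge> 1\<close>, the natural number \<open>k - 1\<close> casts to
    \<open>int k - 1\<close>.\<close>
  then show ?thesis
    using int_sum_descending[of "k - 1" m] assms by (simp add: forb_def of_nat_diff)
qed

end
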